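(* For integers $\alpha,\beta,\gamma,\delta$ and $n\ge 0$ let $$G_{\alpha,\beta,\gamma,\delta}(n):=\det_{0\leq i,j\le n-1}\left(2^{i+\beta}\binom{i+4j+\gamma}{4j+\alpha}+\binom{-i+4j+\delta}{4j+\alpha}\right).$$ For all integers $n\geq2$ the following relations hold: \begin{align*} G_{0, 1, -2, -4}(n) &= 3 \, G_{4, 2, 3, -1}(n-1) = 3 \, G_{8, 3, 8, 2}(n-2),\\ G_{1, 1, 0, -2}(n) &= -2 \, G_{5, 2, 5, 1}(n-1),\\ G_{3, 3, 2, -4}(n) &= -20 \, G_{7, 4, 7, -1}(n-1). \end{align*}
   Context: For an integer $m$ (possibly negative) and an integer $p\ge 0$, $\binom{m}{p}=\frac{m(m-1)\cdots(m-p+1)}{p!}$; for $p<0$, $\binom{m}{p}=0$. The determinant of the empty ($0\times 0$) matrix is $1$. *)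

theory Defs
  imports Complex_Main "Jordan_Normal_Form.Determinant"
begin

definition int_binomial :: "int \<Rightarrow> int \<Rightarrow> rat" where
  "int_binomial m p = (if p < 0 then 0 else of_int m gchoose nat p)"

(* Entries are rational because the exponent of 2 may be negative; hence powi. *)
definition G :: "int \<Rightarrow> int \<Rightarrow> int \<Rightarrow> int \<Rightarrow> nat \<Rightarrow> rat" where
  "G \<alpha> \<beta> \<gamma> \<delta> n =
     det (mat n n (\<lambda>(i, j).
       2 powi (int i + \<beta>) * int_binomial (int i + 4 * int j + \<gamma>) (4 * int j + \<alpha>)
       + int_binomial (- int i + 4 * int j + \<delta>) (4 * int j + \<alpha>)))"

end

(*
  Passing from (alpha, beta, gamma, delta) to (alpha + 4, beta + 1, gamma + 5, delta + 3) shifts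
  the entry at (i, j) to the entry at (i + 1, j + 1), so that the determinant of size n - 1 on the
  right-hand side is the minor obtained by deleting the first row and column on the left-hand side.
  In each of the four cases the first row vanishes except for its leading entry, because
  binomial coefficients with 0 <= top < bottom are zero, and Laplace expansion finishes the proof.
*)
theory Submission
  imports Defs
begin

lemma det_Suc_first_row:
  fixes f :: "nat \<times> nat \<Rightarrow> 'a :: comm_ring_1"
  assumes "\<And>j. j < n \<Longrightarrow> f (0, Suc j) = 0"
  shows "det (mat (Suc n) (Suc n) f) = f (0, 0) * det (mat n n (\<lambda>(i, j). f (Suc i, Suc j)))"
proof -
  let ?A = "mat (Suc n) (Suc n) f"
  have "det ?A = (\<Sum>j<Suc n. ?A $$ (0, j) * cofactor ?A 0 j)"
    by (rule laplace_expansion_row) auto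
  also have "\<dots> = f (0, 0) * cofactor ?A 0 0"
    using assms by (subst sum.lessThan_Suc_shift) simp
  also have "mat_delete ?A 0 0 = mat n n (\<lambda>(i, j). f (Suc i, Suc j))"
    by (rule eq_matI) (auto simp: mat_delete_def)
  then have "cofactor ?A 0 0 = det (mat n n (\<lambda>(i, j). f (Suc i, Suc j)))"
    by (simp add: cofactor_def)
  finally show ?thesis .
qed

text \<open>The sign condition matters: negative tops give nonzero values, e.g.
  \<open>int_binomial (-1) 4 = 1\<close>.\<close>

lemma int_binomial_eq_0:
  assumes "0 \<le> m" "m < p"
  shows "int_binomial m p = 0"
proof -
  obtain k where "m = int k"
    using assms(1) by (rule nonneg_int_cases)
  moreover have "k < nat p"
    using assms calculation by simp
  ultimately show ?thesis
    by (simp add: int_binomial_def flip: binomial_gbinomial)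
qed

text \<open>The bounds put the tops 4j + \<gamma> and 4j + \<delta> of row 0 in the range from 0 to
  below 4j + \<alpha> for every j \<ge> 1; at j = 0 they may be negative.\<close>

lemma G_Suc:
  assumes "0 \<le> \<gamma> + 4" "\<gamma> < \<alpha>" "0 \<le> \<delta> + 4" "\<delta> < \<alpha>"
  shows "G \<alpha> \<beta> \<gamma> \<delta> (Suc n) =
    (2 powi \<beta> * int_binomial \<gamma> \<alpha> + int_binomial \<delta> \<alpha>) * G (\<alpha> + 4) (\<beta> + 1) (\<gamma> + 5) (\<delta> + 3) n"
proof -
  have "G \<alpha> \<beta> \<gamma> \<delta> (Suc n) = (2 powi \<beta> * int_binomial \<gamma> \<alpha> + int_binomial \<delta> \<alpha>) *
    det (mat n n (\<lambda>(i, j).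
      2 powi (int (Suc i) + \<beta>) * int_binomial (int (Suc i) + 4 * int (Suc j) + \<gamma>) (4 * int (Suc j) + \<alpha>)
      + int_binomial (- int (Suc i) + 4 * int (Suc j) + \<delta>) (4 * int (Suc j) + \<alpha>)))"
    unfolding G_def
    by (subst det_Suc_first_row) (use assms in \<open>simp_all add: int_binomial_eq_0\<close>)
  then show ?thesis
    by (simp add: G_def algebra_simps)
qed

theorem proposition22:
  fixes n :: nat
  assumes "n \<ge> 2"
  shows "G 0 1 (-2) (-4) n = 3 * G 4 2 3 (-1) (n - 1)
       \<and> 3 * G 4 2 3 (-1) (n - 1) = 3 * G 8 3 8 2 (n - 2)
       \<and> G 1 1 0 (-2) n = -2 * G 5 2 5 1 (n - 1)
       \<and> G 3 3 2 (-4) n = -20 * G 7 4 7 (-1) (n - 1)"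
proof -
  obtain m where n: "n = Suc (Suc m)"
    using assms by (metis add_2_eq_Suc le_Suc_ex)
  have "G 0 1 (-2) (-4) n = 3 * G 4 2 3 (-1) (n - 1)"
    using G_Suc[of "-2" 0 "-4" 1 "Suc m"] by (simp add: n int_binomial_def)
  \<comment> \<open>Leading entry 4 * C(3,4) + C(-1,4) = 0 + 1.\<close>
  moreover have "G 4 2 3 (-1) (n - 1) = G 8 3 8 2 (n - 2)"
    using G_Suc[of 3 4 "-1" 2 m]
    by (simp add: n int_binomial_def gbinomial_prod_rev numeral_eq_Suc fact_Suc)
  \<comment> \<open>Leading entry 2 * C(0,1) + C(-2,1) = 0 - 2.\<close>
  moreover have "G 1 1 0 (-2) n = -2 * G 5 2 5 1 (n - 1)"
    using G_Suc[of 0 1 "-2" 1 "Suc m"] by (simp add: n int_binomial_def)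
  \<comment> \<open>Leading entry 8 * C(2,3) + C(-4,3) = 0 + (-4)(-5)(-6)/6.\<close>
  moreover have "G 3 3 2 (-4) n = -20 * G 7 4 7 (-1) (n - 1)"
    using G_Suc[of 2 3 "-4" 3 "Suc m"]
    by (simp add: n int_binomial_def gbinomial_prod_rev numeral_eq_Suc fact_Suc)
  ultimately show ?thesis
    by simp
qed

end
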